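(* Let $a<b$ and $\varepsilon>0$ be real, $\mathcal{T}=\mathcal{T}_{a,b,\varepsilon}$, and let $u_*$ be a complex-valued function such that $$u_*=e^{2i\phi(y)}\Big(-\frac{1}{2x}+r_0(y)+r_1(y)\,x+O(x^2)\Big)\quad\text{in }\mathcal{T}\cup\partial\mathcal{T},$$ where $\phi$ is real-valued, $\phi\in C^2([a,b])$, $\;u_*+\dfrac{e^{2i\phi(y)}}{2x}\in C^1(\mathcal{T}\cup\partial\mathcal{T})$, and $$\operatorname{Re} r_0(y)\equiv0,\qquad \operatorname{Im} r_1(y)=\frac12\frac{d^2\phi(y)}{dy^2},\qquad y\in\,]a,b[.$$ Suppose that the equations $$\partial_{\bar\tau}\psi_*=u_*\overline{\psi_*},\qquad \partial_{\bar\tau}\psi_*^+=-\overline{u_*}\,\overline{\psi_*^+}$$ have solutions $\psi_*=f_*$ and $\psi_*^+=f_*^+$, respectively, in $\mathcal{T}$ (away from the pole line $x=0$) such that $$f_*=e^{i\phi(y)}\Big(\frac{\beta_{-1}(y)}{x}+\beta_0(y)+O(x)\Big),\qquad f_*-\frac{e^{i\phi(y)}\beta_{-1}(y)}{x}\in C^1(\mathcal{T}\cup\partial\mathcal{T}),$$ $$f_*^+=e^{-i(\phi(y)+\pi/2)}\Big(\frac{\beta_{-1}^+(y)}{x}+\beta_0^+(y)+O(x)\Big),\qquad f_*^+-\frac{e^{-i(\phi(y)+\pi/2)}\beta_{-1}^+(y)}{x}\in C^1(\mathcal{T}\cup\partial\mathcal{T}),$$ where $\beta_{-1},\beta_{-1}^+\in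 C^1([a,b])$ are real-valued, $\beta_{-1}>0$, $\beta_{-1}^+>0$, and the remainders $O(x)$ satisfy $\partial_xO(x)=O(1)$, $\partial_yO(x)=O(x)$. Let $\omega_{f_*,f_*^+}$ be some potential of the pair $f_*,f_*^+$. Then there is $\delta\in\,]0,\varepsilon[$ such that the simple Moutard transform of $u_*$, $$\tilde u_*=\mathcal{M}_{u_*,f_*,f_*^+}u_*=u_*+\frac{f_*\overline{f_*^+}}{\omega_{f_*,f_*^+}},$$ satisfies $$\tilde u_*=O(1)\quad\text{in }\mathcal{T}_{a,b,\delta}\cup\partial\mathcal{T}_{a,b,\delta}.$$
   Context: For real $a<b$ and $\varepsilon>0$, $\mathcal{T}_{a,b,\varepsilon}=\{\tau\in\mathbb{C}: a<\operatorname{Im}\tau<b,\ |\operatorname{Re}\tau|<\varepsilon\}$, with $\partial\mathcal{T}_{a,b,\varepsilon}$ its boundary; write $\tau=x+iy$, $\bar\tau=x-iy$ with $x,y$ real, and $\partial_\tau,\partial_{\bar\tau}$ for the Wirtinger derivatives. The pole contour is the line $\Gamma_*=\{\tau\in\mathcal{T}_{a,b,\varepsilon}:\operatorname{Re}\tau=0\}$; functions with a pole at $x=0$ are considered, and the equations hold, off $x=0$. $O(\cdot)$ is understood as $x\to0$, uniformly in $y\in[a,b]$; in particular $\tilde u_*=O(1)$ means that $\tilde u_*$ is bounded on the set in question (off $x=0$). $]p,q[$ denotes the open interval. A potential $\omega_{f_*,f_*^+}$ is a purely imaginary-valued function (off $x=0$) with $\partial_\tau\omega_{f_*,f_*^+}=f_*f_*^+$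 and $\partial_{\bar\tau}\omega_{f_*,f_*^+}=-\overline{f_*f_*^+}$; it is defined up to imaginary integration constants. *)

theory Defs
  imports "HOL-Analysis.Analysis" "HOL-Library.Landau_Symbols"
begin

definition strip :: "real \<Rightarrow> real \<Rightarrow> real \<Rightarrow> complex set" where
  "strip a b \<epsilon> = {\<tau>. a < Im \<tau> \<and> Im \<tau> < b \<and> \<bar>Re \<tau>\<bar> < \<epsilon>}"

definition off_pole :: "complex set \<Rightarrow> complex set" where
  "off_pole S = {\<tau> \<in> S. Re \<tau> \<noteq> 0}"

(* Filter on pairs (x, y) expressing "as x tends to 0, uniformly in y in [a,b]". *)
definition near_pole :: "real \<Rightarrow> real \<Rightarrow> (real \<times> real) filter" where
  "near_pole a b = at 0 \<times>\<^sub>F principal {a..b}"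

(* Used for nondegenerate closed intervals and rectangles, where the derivative relative to S is
   unique; at boundary points it is one-sided. *)
definition C1_on :: "'a::real_normed_vector set \<Rightarrow> ('a \<Rightarrow> 'b::real_normed_vector) \<Rightarrow> bool" where
  "C1_on S f \<longleftrightarrow>
    (\<exists>D :: 'a \<Rightarrow> 'a \<Rightarrow>\<^sub>L 'b.
      (\<forall>x\<in>S. (f has_derivative blinfun_apply (D x)) (at x within S)) \<and> continuous_on S D)"

definition C2_on :: "real set \<Rightarrow> (real \<Rightarrow> real) \<Rightarrow> bool" where
  "C2_on S f \<longleftrightarrow>
    (\<exists>D. (\<forall>y\<in>S. (f has_real_derivative D y) (at y within S)) \<and> C1_on S D)"

(* Membership in C^1(S) for a function given only off x = 0: the function is the restriction of
   a C^1 function on S. *)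
definition extends_C1_on :: "complex set \<Rightarrow> (complex \<Rightarrow> complex) \<Rightarrow> bool" where
  "extends_C1_on S f \<longleftrightarrow> (\<exists>g. C1_on S g \<and> (\<forall>\<tau>\<in>off_pole S. g \<tau> = f \<tau>))"

definition wirtinger_d :: "(complex \<Rightarrow> complex) \<Rightarrow> complex \<Rightarrow> complex" where
  "wirtinger_d f \<tau> = (frechet_derivative f (at \<tau>) 1 - \<i> * frechet_derivative f (at \<tau>) \<i>) / 2"

definition wirtinger_dbar :: "(complex \<Rightarrow> complex) \<Rightarrow> complex \<Rightarrow> complex" where
  "wirtinger_dbar f \<tau> = (frechet_derivative f (at \<tau>) 1 + \<i> * frechet_derivative f (at \<tau>) \<i>) / 2"

definition generalized_analytic_on ::
    "complex set \<Rightarrow> (complex \<Rightarrow> complex) \<Rightarrow> (complex \<Rightarrow> complex) \<Rightarrow> bool" where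
  "generalized_analytic_on D u \<psi> \<longleftrightarrow>
    (\<forall>\<tau>\<in>D. \<psi> differentiable (at \<tau>) \<and> wirtinger_dbar \<psi> \<tau> = u \<tau> * cnj (\<psi> \<tau>))"

definition potential_on ::
    "complex set \<Rightarrow> (complex \<Rightarrow> complex) \<Rightarrow> (complex \<Rightarrow> complex) \<Rightarrow> (complex \<Rightarrow> complex) \<Rightarrow> bool" where
  "potential_on D f fp \<omega> \<longleftrightarrow>
    (\<forall>\<tau>\<in>D. Re (\<omega> \<tau>) = 0 \<and> \<omega> differentiable (at \<tau>) \<and>
       wirtinger_d \<omega> \<tau> = f \<tau> * fp \<tau> \<and> wirtinger_dbar \<omega> \<tau> = - cnj (f \<tau> * fp \<tau>))"

definition simple_moutard ::
    "(complex \<Rightarrow> complex) \<Rightarrow> (complex \<Rightarrow> complex) \<Rightarrow> (complex \<Rightarrow> complex) \<Rightarrow> (complex \<Rightarrow> complex)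
      \<Rightarrow> complex \<Rightarrow> complex" where
  "simple_moutard u f fp \<omega> \<tau> = u \<tau> + f \<tau> * cnj (fp \<tau>) / \<omega> \<tau>"

(* A remainder O(x) whose x- and y-derivatives exist and are O(1) and O(x), respectively; the
   y-derivative is one-sided at y = a and y = b. *)
definition smooth_remainder :: "real \<Rightarrow> real \<Rightarrow> (real \<Rightarrow> real \<Rightarrow> complex) \<Rightarrow> bool" where
  "smooth_remainder a b R \<longleftrightarrow>
    (\<lambda>(x, y). R x y) \<in> O[near_pole a b](\<lambda>(x, y). of_real x) \<and>
    (\<forall>\<^sub>F (x, y) in near_pole a b.
       (\<lambda>s. R s y) differentiable (at x) \<and> R x differentiable (at y within {a..b})) \<and>
    (\<lambda>(x, y). vector_derivative (\<lambda>s. R s y) (at x)) \<in> O[near_pole a b](\<lambda>_. 1) \<and>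
    (\<lambda>(x, y). vector_derivative (R x) (at y within {a..b})) \<in> O[near_pole a b](\<lambda>(x, y). of_real x)"

end

theory Submission
  imports Defs
begin

text \<open>
  Write \<open>f = cis \<phi> * (\<beta> / x + h)\<close> and \<open>fp = - \<i> * cis (- \<phi>) * (\<beta>p / x + k)\<close> with \<open>h\<close> and \<open>k\<close> bounded. Then
  \<open>f * cnj fp = \<i> * cis (2 * \<phi>) * (\<beta> / x + h) * (\<beta>p / x + cnj k)\<close> has the double pole
  \<open>\<i> * cis (2 * \<phi>) * \<beta> * \<beta>p / x^2\<close>. If the potential is \<open>2 * \<i> * \<beta> * \<beta>p / x\<close> up to a bounded error, the
  quotient is \<open>cis (2 * \<phi>) / (2 * x)\<close> up to a bounded error (\<open>pole_cancellation\<close>), and this is exactly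
  opposite to the pole of \<open>u\<close>.

  The potential has \<open>x\<close>-derivative \<open>2 * \<i> * Im (f * fp)\<close>, which equals
  \<open>- 2 * \<i> * Re ((\<beta> / x + h) * (\<beta>p / x + k))\<close>. Its double pole integrates to the pole wanted. Its simple
  pole would integrate to a logarithm, so it has to be absent: the limits \<open>\<beta>0\<close> and \<open>\<beta>p0\<close> of \<open>h\<close> and \<open>k\<close> must
  satisfy \<open>\<beta> * Re \<beta>p0 + \<beta>p * Re \<beta>0 = 0\<close>.

  This relation comes from the equations for \<open>f\<close> and \<open>fp\<close>. Comparing the coefficients of \<open>1 / x\<close> in the first
  one gives \<open>\<i> * \<beta>' - \<phi>' * \<beta> = 2 * r0 * \<beta> - cnj \<beta>0\<close> (\<open>subleading_coefficient\<close>), and since \<open>r0\<close> is imaginary,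
  \<open>Re \<beta>0 = \<phi>' * \<beta>\<close> (\<open>Re_subleading_coefficient\<close>). The second equation is of the same form with the phase
  \<open>- (\<phi> + pi / 2)\<close>, hence \<open>Re \<beta>p0 = - \<phi>' * \<beta>p\<close>, and the two contributions cancel.

  What remains of the derivative is bounded uniformly in \<open>y\<close>. Integrating it from \<open>x = \<plusminus>\<delta>\<close>, where the
  potential is bounded by compactness, bounds the error
  (\<open>bounded_near_pole_if_x_derivative_bounded\<close>).
\<close>

section \<open>Strips and uniform remainders\<close>

lemma strip_eq_box: "strip a b \<epsilon> = box (Complex (- \<epsilon>) a) (Complex \<epsilon> b)"
  by (auto simp: strip_def in_box_complex_iff)

lemma closure_strip:
  assumes "a < b" and "0 < \<epsilon>"
  shows "closure (strip a b \<epsilon>) = {\<tau>. a \<le> Im \<tau> \<and> Im \<tau> \<le> b \<and> \<bar>Re \<tau>\<bar> \<le> \<epsilon>}"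
proof -
  have "strip a b \<epsilon> \<noteq> {}"
    using assms by (auto simp: strip_eq_box box_ne_empty Basis_complex_def inner_complex_def)
  then have "closure (strip a b \<epsilon>) = cbox (Complex (- \<epsilon>) a) (Complex \<epsilon> b)"
    by (simp add: strip_eq_box)
  also have "\<dots> = {\<tau>. a \<le> Im \<tau> \<and> Im \<tau> \<le> b \<and> \<bar>Re \<tau>\<bar> \<le> \<epsilon>}"
    by (auto simp: in_cbox_complex_iff)
  finally show ?thesis .
qed

lemma compact_closure_strip: "compact (closure (strip a b \<epsilon>))"
  using bounded_box compact_closure by (simp add: strip_eq_box)

lemma open_strip: "open (strip a b \<epsilon>)"
  by (simp add: strip_eq_box open_box)

lemma open_off_pole: "open S \<Longrightarrow> open (off_pole S)"
proof -
  assume "open S"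
  moreover have "off_pole S = S \<inter> {\<tau>. Re \<tau> \<noteq> 0}"
    by (auto simp: off_pole_def)
  moreover have "open {\<tau>. Re \<tau> \<noteq> 0}"
    by (intro open_Collect_neq continuous_intros)
  ultimately show ?thesis by auto
qed

text \<open>The second factor of the filter is principal, so the constant and the radius obtained here serve
  all \<open>y\<close> in \<open>[a, b]\<close>, endpoints included.\<close>
lemma bigo_near_pole_uniform:
  fixes R :: "real \<Rightarrow> real \<Rightarrow> complex" and h :: "real \<Rightarrow> complex"
  assumes "(\<lambda>(x, y). R x y) \<in> O[near_pole a b](\<lambda>(x, y). h x)"
  obtains C d where "0 < C" "0 < d"
    "\<And>x y. 0 < \<bar>x\<bar> \<Longrightarrow> \<bar>x\<bar> < d \<Longrightarrow> a \<le> y \<Longrightarrow> y \<le> b \<Longrightarrow> norm (R x y) \<le> C * norm (h x)"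
proof -
  obtain C where C: "0 < C"
    and ev: "\<forall>\<^sub>F z in near_pole a b. norm (R (fst z) (snd z)) \<le> C * norm (h (fst z))"
    using landau_o.bigE[OF assms] by (auto simp: case_prod_beta)
  obtain P Q where P: "eventually P (at 0)" and Q: "\<And>y. y \<in> {a..b} \<Longrightarrow> Q y"
    and PQ: "\<And>x y. P x \<Longrightarrow> Q y \<Longrightarrow> norm (R x y) \<le> C * norm (h x)"
    using ev unfolding near_pole_def eventually_prod_filter eventually_principal fst_conv snd_conv by blast
  obtain d where "0 < d" "\<And>x. x \<noteq> 0 \<Longrightarrow> \<bar>x\<bar> < d \<Longrightarrow> P x"
    using P unfolding eventually_at by (auto simp: dist_real_def)
  then show ?thesis
    using that[OF C] Q PQ by auto
qed

lemma bigo_near_pole_tendsto_0: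
  fixes R :: "real \<Rightarrow> real \<Rightarrow> complex" and h :: "real \<Rightarrow> complex"
  assumes "(\<lambda>(x, y). R x y) \<in> O[near_pole a b](\<lambda>(x, y). h x)"
    and h: "(h \<longlongrightarrow> 0) (at_right 0)" and y: "y \<in> {a..b}"
  shows "((\<lambda>x. R x y) \<longlongrightarrow> 0) (at_right 0)"
proof -
  obtain C d where "0 < C" "0 < d" and le:
    "\<And>x y. 0 < \<bar>x\<bar> \<Longrightarrow> \<bar>x\<bar> < d \<Longrightarrow> a \<le> y \<Longrightarrow> y \<le> b \<Longrightarrow> norm (R x y) \<le> C * norm (h x)"
    using bigo_near_pole_uniform[OF assms(1)] by blast
  show ?thesis
  proof (rule Lim_null_comparison)
    show "\<forall>\<^sub>F x in at_right 0. norm (R x y) \<le> C * norm (h x)"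
      using eventually_at_right_real[OF \<open>0 < d\<close>]
    proof eventually_elim
      case (elim x)
      then show ?case using le[of x y] y by simp
    qed
    show "((\<lambda>x. C * norm (h x)) \<longlongrightarrow> 0) (at_right 0)"
      by (rule tendsto_mult_right_zero[OF tendsto_norm_zero[OF h]])
  qed
qed

lemma tendsto_complex_of_real_0: "(complex_of_real \<longlongrightarrow> 0) (at_right 0)"
  using tendsto_of_real[OF tendsto_ident_at] by (metis of_real_0)

section \<open>Functions of class \<open>C\<^sup>1\<close> and bounds near the pole line\<close>

lemma C1_on_imp_continuous_on: "C1_on S f \<Longrightarrow> continuous_on S f"
  unfolding C1_on_def continuous_on_eq_continuous_within
  using has_derivative_continuous by blast

lemma C1_on_real_derivative:
  assumes "C1_on {a..b} f" "a < y" "y < b"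
  obtains q where "((f::real\<Rightarrow>real) has_real_derivative q) (at y)"
proof -
  obtain D where "(f has_derivative D) (at y within {a..b})"
    using assms unfolding C1_on_def by (metis atLeastAtMost_iff less_imp_le)
  then have "(f has_derivative D) (at y)"
    using assms at_within_interior[of y "{a..b}"] by (simp add: interior_atLeastAtMost_real)
  then show ?thesis
    using has_real_derivative that by blast
qed

lemma bounded_if_extends_C1_on:
  assumes "extends_C1_on (closure (strip a b \<epsilon>)) f"
  obtains M where "0 < M" "\<And>\<tau>. \<tau> \<in> off_pole (closure (strip a b \<epsilon>)) \<Longrightarrow> norm (f \<tau>) \<le> M"
proof -
  obtain g where g: "C1_on (closure (strip a b \<epsilon>)) g"
    and gf: "\<And>\<tau>. \<tau> \<in> off_pole (closure (strip a b \<epsilon>)) \<Longrightarrow> g \<tau> = f \<tau>"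
    using assms unfolding extends_C1_on_def by blast
  have "bounded (g ` closure (strip a b \<epsilon>))"
    using compact_continuous_image[OF C1_on_imp_continuous_on[OF g]] compact_closure_strip
      compact_imp_bounded by blast
  then obtain M where "0 < M" and M: "\<And>\<tau>. \<tau> \<in> closure (strip a b \<epsilon>) \<Longrightarrow> norm (g \<tau>) \<le> M"
    unfolding bounded_pos by auto
  show ?thesis
  proof (rule that[OF \<open>0 < M\<close>])
    fix \<tau> assume \<tau>: "\<tau> \<in> off_pole (closure (strip a b \<epsilon>))"
    then show "norm (f \<tau>) \<le> M"
      using M[of \<tau>] gf[OF \<tau>] by (simp add: off_pole_def)
  qed
qed

text \<open>Each side of the pole line is reached horizontally from the segment \<open>x = \<plusminus>\<delta>\<close>, which is compact and
  avoids the pole, so the mean value theorem bounds \<open>F\<close> for \<open>a < y < b\<close>; continuity carries the bound to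
  the edges \<open>y = a\<close> and \<open>y = b\<close>. This is how the integration
  constants of a potential, one for each side, are kept under control.\<close>
lemma bounded_near_pole_if_x_derivative_bounded:
  fixes F F' :: "complex \<Rightarrow> complex"
  assumes "a < b" "0 < \<delta>" "\<delta> < \<epsilon>"
    and cont: "continuous_on (off_pole (closure (strip a b \<epsilon>))) F"
    and deriv: "\<And>x y. 0 < \<bar>x\<bar> \<Longrightarrow> \<bar>x\<bar> \<le> \<delta> \<Longrightarrow> a < y \<Longrightarrow> y < b \<Longrightarrow>
      ((\<lambda>s. F (Complex s y)) has_vector_derivative F' (Complex x y)) (at x)"
    and bound: "\<And>x y. 0 < \<bar>x\<bar> \<Longrightarrow> \<bar>x\<bar> \<le> \<delta> \<Longrightarrow> a < y \<Longrightarrow> y < b \<Longrightarrow> norm (F' (Complex x y)) \<le> K"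
  obtains M where "0 < M"
    "\<And>x y. 0 < \<bar>x\<bar> \<Longrightarrow> \<bar>x\<bar> \<le> \<delta> \<Longrightarrow> a \<le> y \<Longrightarrow> y \<le> b \<Longrightarrow> norm (F (Complex x y)) \<le> M"
proof -
  have in_strip: "Complex x y \<in> off_pole (closure (strip a b \<epsilon>))"
    if "0 < \<bar>x\<bar>" "\<bar>x\<bar> \<le> \<delta>" "a \<le> y" "y \<le> b" for x y
    using that assms by (simp add: off_pole_def closure_strip)
  have cont_y: "continuous_on {a..b} (\<lambda>y. F (Complex x y))" if "0 < \<bar>x\<bar>" "\<bar>x\<bar> \<le> \<delta>" for x
    by (rule continuous_on_compose2[OF cont])
       (use that in_strip in \<open>auto intro!: continuous_intros\<close>)
  have "\<exists>B. \<forall>y\<in>{a..b}. norm (F (Complex x y)) \<le> B" if "0 < \<bar>x\<bar>" "\<bar>x\<bar> \<le> \<delta>" for x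
    using compact_imp_bounded[OF compact_continuous_image[OF cont_y[OF that] compact_Icc]]
    unfolding bounded_iff by auto
  from this[of \<delta>] this[of "- \<delta>"] obtain B1 B2
    where B: "\<forall>y\<in>{a..b}. norm (F (Complex \<delta> y)) \<le> B1"
      "\<forall>y\<in>{a..b}. norm (F (Complex (- \<delta>) y)) \<le> B2"
    using \<open>0 < \<delta>\<close> by fastforce
  define M where "M = \<bar>B1\<bar> + \<bar>B2\<bar> + K * \<delta>"
  have "0 \<le> K"
    using order_trans[OF norm_ge_zero bound[of \<delta> "(a + b) / 2"]] \<open>0 < \<delta>\<close> \<open>a < b\<close> by simp
  have inner: "norm (F (Complex x y)) \<le> M" if x: "0 < \<bar>x\<bar>" "\<bar>x\<bar> \<le> \<delta>" and y: "a < y" "y < b" for x y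
  proof -
    \<comment> \<open>the point of the compact segment on the same side of the pole line\<close>
    define x1 where "x1 = sgn x * \<delta>"
    have seg: "0 < \<bar>s\<bar> \<and> \<bar>s\<bar> \<le> \<delta>" if "s \<in> closed_segment x x1" for s
      using that x \<open>0 < \<delta>\<close> unfolding x1_def closed_segment_eq_real_ivl by (cases "0 < x") (auto split: if_splits)
    have "norm (F (Complex x y) - F (Complex x1 y)) \<le> K * norm (x - x1)"
    proof (rule differentiable_bound)
      show "((\<lambda>s. F (Complex s y)) has_derivative (\<lambda>t. t *\<^sub>R F' (Complex s y)))
          (at s within closed_segment x x1)"
        if "s \<in> closed_segment x x1" for s
        using deriv[of s y] seg[OF that] y has_derivative_at_withinI
        unfolding has_vector_derivative_def by blast
      show "onorm (\<lambda>t. t *\<^sub>R F' (Complex s y)) \<le> K" if "s \<in> closed_segment x x1" for s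
      proof (rule onorm_bound[OF \<open>0 \<le> K\<close>])
        show "norm (t *\<^sub>R F' (Complex s y)) \<le> K * norm t" for t
          using mult_left_mono[OF bound[of s y] abs_ge_zero[of t]] seg[OF that] y
          by (simp add: mult.commute)
      qed
    qed auto
    also have "\<dots> \<le> K * \<delta>"
      using x \<open>0 \<le> K\<close> by (intro mult_left_mono) (cases "0 < x"; auto simp: x1_def)+
    finally have "norm (F (Complex x y)) \<le> norm (F (Complex x1 y)) + K * \<delta>"
      using norm_triangle_sub[of "F (Complex x y)" "F (Complex x1 y)"] by simp
    moreover have "norm (F (Complex x1 y)) \<le> \<bar>B1\<bar> + \<bar>B2\<bar>"
      using bspec[OF B(1), of y] bspec[OF B(2), of y] x y by (cases "0 < x") (auto simp: x1_def)
    ultimately show ?thesis by (simp add: M_def)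
  qed
  have "norm (F (Complex x y)) \<le> M" if x: "0 < \<bar>x\<bar>" "\<bar>x\<bar> \<le> \<delta>" and y: "a \<le> y" "y \<le> b" for x y
  proof (rule continuous_le_on_closure[of "{a<..<b}" "\<lambda>y. norm (F (Complex x y))"])
    show "continuous_on (closure {a<..<b}) (\<lambda>y. norm (F (Complex x y)))"
      using cont_y[OF x] \<open>a < b\<close> by (auto intro!: continuous_intros)
  qed (use x y \<open>a < b\<close> inner in auto)
  then have "norm (F (Complex x y)) \<le> M + 1" if "0 < \<bar>x\<bar>" "\<bar>x\<bar> \<le> \<delta>" "a \<le> y" "y \<le> b" for x y
    using that by (meson add_increasing2 zero_le_one)
  \<comment> \<open>\<open>M\<close> itself may vanish, and the claim asks for a positive bound\<close>
  moreover have "0 < M + 1" using \<open>0 \<le> K\<close> \<open>0 < \<delta>\<close> by (simp add: M_def add_nonneg_pos)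
  ultimately show ?thesis using that by blast
qed

section \<open>The subleading coefficient of a generalized analytic function\<close>

text \<open>The product rule applied to \<open>cis \<phi> * \<beta> / x\<close>: differentiating \<open>1 / x\<close> produces the double pole,
  while differentiating \<open>cis \<phi> * \<beta>\<close> in \<open>y\<close> produces the simple one.\<close>
lemma dbar_polar_part:
  fixes g :: "complex \<Rightarrow> complex"
  assumes "x \<noteq> 0"
    and \<phi>: "(\<phi> has_real_derivative p) (at y)" and \<beta>: "(\<beta> has_real_derivative q) (at y)"
    and g: "(g has_derivative D) (at (Complex x y))"
    and U: "open U" "Complex x y \<in> U"
    and f: "\<And>\<tau>. \<tau> \<in> U \<Longrightarrow>
      f \<tau> = cis (\<phi> (Im \<tau>)) * of_real (\<beta> (Im \<tau>)) / of_real (Re \<tau>) + g \<tau>"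
  shows "2 * wirtinger_dbar f (Complex x y) =
    cis (\<phi> y) * (- \<beta> y / x^2 + (- (p * \<beta> y) + \<i> * q) / x) + (D 1 + \<i> * D \<i>)"
proof -
  have \<phi>': "((\<lambda>\<tau>. \<phi> (Im \<tau>)) has_derivative (\<lambda>h. Im h * p)) (at (Complex x y))"
    by (rule has_derivative_eq_rhs[OF has_derivative_compose[OF has_derivative_Im[OF has_derivative_ident]]])
       (use \<phi> in \<open>auto simp: has_field_derivative_def mult_commute_abs\<close>)
  have \<beta>': "((\<lambda>\<tau>. \<beta> (Im \<tau>)) has_derivative (\<lambda>h. Im h * q)) (at (Complex x y))"
    by (rule has_derivative_eq_rhs[OF has_derivative_compose[OF has_derivative_Im[OF has_derivative_ident]]])
       (use \<beta> in \<open>auto simp: has_field_derivative_def mult_commute_abs\<close>)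
  let ?E = "cis (\<phi> y)"
  have "((\<lambda>\<tau>. cis (\<phi> (Im \<tau>)) * of_real (\<beta> (Im \<tau>)) / of_real (Re \<tau>) + g \<tau>) has_derivative
      (\<lambda>h. ?E * (of_real (Im h) * (\<i> * p * \<beta> y + q) / x - of_real (Re h) * \<beta> y / x^2) + D h))
      (at (Complex x y))"
  proof (rule has_derivative_eq_rhs)
    show "((\<lambda>\<tau>. cis (\<phi> (Im \<tau>)) * of_real (\<beta> (Im \<tau>)) / of_real (Re \<tau>) + g \<tau>) has_derivative
      (\<lambda>h. (- (?E * of_real (\<beta> y)) * (inverse (of_real x) * of_real (Re h) * inverse (of_real x))
          + (?E * of_real (Im h * q) + (Im h * p) *\<^sub>R (\<i> * ?E) * of_real (\<beta> y)) / of_real x) + D h))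
      (at (Complex x y))"
      by (rule has_derivative_eq_rhs, rule derivative_intros \<phi>' \<beta>' g has_derivative_of_real has_derivative_Re | simp add: \<open>x \<noteq> 0\<close>)+
  qed (simp add: fun_eq_iff scaleR_conv_of_real divide_inverse power2_eq_square algebra_simps)
  then have "(f has_derivative
      (\<lambda>h. ?E * (of_real (Im h) * (\<i> * p * \<beta> y + q) / x - of_real (Re h) * \<beta> y / x^2) + D h))
      (at (Complex x y))"
    by (rule has_derivative_transform_within_open[OF _ U]) (simp add: f)
  from frechet_derivative_at[OF this, symmetric]
  have "2 * wirtinger_dbar f (Complex x y) =
      (?E * (- \<beta> y / x^2) + D 1) + \<i> * (?E * ((\<i> * p * \<beta> y + q) / x) + D \<i>)"
    unfolding wirtinger_dbar_def by simp
  also have "\<dots> = ?E * (- \<beta> y / x^2 + (\<i> * \<i> * (p * \<beta> y) + \<i> * q) / x) + (D 1 + \<i> * D \<i>)"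
    by (simp only: distrib_left add_divide_distrib) (simp add: mult_ac)
  finally show ?thesis by simp
qed

text \<open>Insert both expansions into \<open>2 * wirtinger_dbar f = 2 * u * cnj f\<close> and divide by \<open>cis \<phi>\<close>. The double
  poles agree because the coefficient of the pole of \<open>u\<close> is \<open>- 1 / 2\<close>; the identity claimed is the equality
  of the coefficients of \<open>1 / x\<close>. It is read off by multiplying by \<open>x\<close> and letting \<open>x\<close> tend to \<open>0\<close> from the
  right with \<open>y\<close> fixed. The regular part is kept as one function \<open>g\<close> because only as a whole is it known
  to be of class \<open>C\<^sup>1\<close>.\<close>
lemma subleading_coefficient:
  fixes f g u :: "complex \<Rightarrow> complex"
  assumes "a < y" "y < b" "0 < \<epsilon>"
    and \<phi>: "(\<phi> has_real_derivative p) (at y)" and \<beta>: "(\<beta> has_real_derivative q) (at y)"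
    and g: "C1_on (closure (strip a b \<epsilon>)) g"
    and f: "\<And>\<tau>. \<tau> \<in> off_pole (closure (strip a b \<epsilon>)) \<Longrightarrow>
      f \<tau> = cis (\<phi> (Im \<tau>)) * of_real (\<beta> (Im \<tau>)) / of_real (Re \<tau>) + g \<tau>"
    and eq: "generalized_analytic_on (off_pole (strip a b \<epsilon>)) u f"
    and u: "\<And>x. 0 < x \<Longrightarrow> x < \<epsilon> \<Longrightarrow> u (Complex x y) = cis (2 * \<phi> y) * (- 1 / (2 * of_real x) + v x)"
    and v: "(v \<longlongrightarrow> r) (at_right 0)"
    and c: "((\<lambda>x. cis (- \<phi> y) * g (Complex x y)) \<longlongrightarrow> c) (at_right 0)"
  shows "- (p * \<beta> y) + \<i> * q = 2 * r * \<beta> y - cnj c"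
proof -
  let ?S = "closure (strip a b \<epsilon>)" and ?E = "cis (\<phi> y)"
  obtain D :: "complex \<Rightarrow> complex \<Rightarrow>\<^sub>L complex" where D: "\<And>\<tau>. \<tau> \<in> ?S \<Longrightarrow> (g has_derivative D \<tau>) (at \<tau> within ?S)"
    and contD: "continuous_on ?S D"
    using g unfolding C1_on_def by blast
  have ab: "a < b" using assms by simp
  have inS: "Complex x y \<in> off_pole (strip a b \<epsilon>)" if "0 < x" "x < \<epsilon>" for x
    using that assms by (simp add: off_pole_def strip_def)
  have sub: "off_pole (strip a b \<epsilon>) \<subseteq> off_pole ?S"
    using closure_subset by (auto simp: off_pole_def)
  define N where "N x = D (Complex x y) 1 + \<i> * D (Complex x y) \<i>" for x
  have dbar: "?E * (- \<beta> y / x^2 + (- (p * \<beta> y) + \<i> * q) / x) + N x =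
      2 * u (Complex x y) * cnj (f (Complex x y))" if x: "0 < x" "x < \<epsilon>" for x
  proof -
    have "(g has_derivative D (Complex x y)) (at (Complex x y) within strip a b \<epsilon>)"
      using D[of "Complex x y"] inS[OF x] closure_subset has_derivative_subset
      by (metis (no_types, lifting) mem_Collect_eq off_pole_def subsetD)
    then have "(g has_derivative D (Complex x y)) (at (Complex x y))"
      using inS[OF x] at_within_open[OF _ open_strip] by (simp add: off_pole_def)
    from dbar_polar_part[OF _ \<phi> \<beta> this open_off_pole[OF open_strip] inS[OF x], of f] x f sub
    have "2 * wirtinger_dbar f (Complex x y) =
        ?E * (- \<beta> y / x^2 + (- (p * \<beta> y) + \<i> * q) / x) + N x"
      by (auto simp: N_def)
    moreover have "wirtinger_dbar f (Complex x y) = u (Complex x y) * cnj (f (Complex x y))"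
      using eq inS[OF x] unfolding generalized_analytic_on_def by blast
    ultimately show ?thesis by (metis mult.assoc)
  qed
  have EE: "?E * cnj ?E = 1" by (simp add: cis_cnj cis_mult)
  \<comment> \<open>the equation times \<open>x * cnj ?E\<close>, with the double poles cancelled: every term now has a limit\<close>
  have id: "(- (p * \<beta> y) + \<i> * q) + of_real x * (cnj ?E * N x) =
     2 * v x * \<beta> y - cnj (cis (- \<phi> y) * g (Complex x y))
       + of_real x * (2 * ?E * v x * cnj (g (Complex x y)))" if x: "0 < x" "x < \<epsilon>" for x
  proof -
    define X where "X = complex_of_real x"
    have X: "X \<noteq> 0" using x by (simp add: X_def)
    let ?g = "g (Complex x y)"
    have cis2: "cis (2 * \<phi> y) = ?E * ?E" by (simp add: cis_mult)
    have "f (Complex x y) = ?E * \<beta> y / X + ?g"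
      using f[of "Complex x y"] inS[OF x] sub by (auto simp: X_def)
    with dbar[OF x] u[OF x] have e: "?E * (- \<beta> y / X^2 + (- (p * \<beta> y) + \<i> * q) / X) + N x =
      2 * (?E * ?E * (- 1 / (2 * X) + v x)) * (cnj ?E * \<beta> y / X + cnj ?g)"
      by (simp add: X_def cis2)
    have "(- (p * \<beta> y) + \<i> * q) + X * (cnj ?E * N x) =
      X * cnj ?E * (?E * (- \<beta> y / X^2 + (- (p * \<beta> y) + \<i> * q) / X) + N x) + (?E * cnj ?E) * \<beta> y / X
       + (1 - ?E * cnj ?E) * (- (p * \<beta> y) + \<i> * q)"
      using X by (simp add: field_simps power2_eq_square)
    also have "\<dots> = X * cnj ?E * (2 * (?E * ?E * (- 1 / (2 * X) + v x)) * (cnj ?E * \<beta> y / X + cnj ?g)) + \<beta> y / X"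
      unfolding e EE by simp
    also have "\<dots> = X * (?E * cnj ?E) * (2 * (- 1 / (2 * X) + v x)) * ((?E * cnj ?E) * \<beta> y / X + ?E * cnj ?g) + \<beta> y / X"
      by (simp add: algebra_simps)
    also have "\<dots> = 2 * v x * \<beta> y - ?E * cnj ?g + X * (2 * ?E * v x * cnj ?g)"
      unfolding EE using X by (simp add: field_simps)
    finally show ?thesis by (simp add: X_def cis_cnj)
  qed
  have path: "((\<lambda>x. h (Complex x y)) \<longlongrightarrow> h (Complex 0 y)) (at_right 0)" if "continuous_on ?S h" for h :: "complex \<Rightarrow> 'z::topological_space"
  proof -
    have "continuous_on {0..\<epsilon>} (\<lambda>x. h (Complex x y))"
      by (rule continuous_on_compose2[OF that])
         (use assms ab in \<open>auto intro!: continuous_intros simp: closure_strip\<close>)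
    then show ?thesis
      using \<open>0 < \<epsilon>\<close> by (metis continuous_on_Icc_at_rightD)
  qed
  have n: "(N \<longlongrightarrow> N 0) (at_right 0)"
    unfolding N_def by (intro tendsto_add tendsto_mult tendsto_const blinfun.tendsto path[OF contD])
  have lhs: "((\<lambda>x. (- (p * \<beta> y) + \<i> * q) + of_real x * (cnj ?E * N x)) \<longlongrightarrow>
      (- (p * \<beta> y) + \<i> * q) + 0 * (cnj ?E * N 0)) (at_right 0)"
    by (intro tendsto_intros tendsto_complex_of_real_0 n)
  have rhs: "((\<lambda>x. 2 * v x * \<beta> y - cnj (cis (- \<phi> y) * g (Complex x y))
       + of_real x * (2 * ?E * v x * cnj (g (Complex x y)))) \<longlongrightarrow>
      2 * r * \<beta> y - cnj c + 0 * (2 * ?E * r * cnj (g (Complex 0 y)))) (at_right 0)"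
    by (intro tendsto_intros tendsto_complex_of_real_0 v c path C1_on_imp_continuous_on[OF g])
  have ev: "\<forall>\<^sub>F x in at_right 0. (- (p * \<beta> y) + \<i> * q) + of_real x * (cnj ?E * N x) =
     2 * v x * \<beta> y - cnj (cis (- \<phi> y) * g (Complex x y))
       + of_real x * (2 * ?E * v x * cnj (g (Complex x y)))"
    using eventually_at_right_less[of 0] eventually_at_right_real[OF \<open>0 < \<epsilon>\<close>]
    by eventually_elim (rule id, auto)
  have "(- (p * \<beta> y) + \<i> * q) + 0 * (cnj ?E * N 0) =
     2 * r * \<beta> y - cnj c + 0 * (2 * ?E * r * cnj (g (Complex 0 y)))"
    by (rule tendsto_unique[OF trivial_limit_at_right_real lhs tendsto_cong[OF ev, THEN iffD2, OF rhs]])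
  then show ?thesis by simp
qed

text \<open>When \<open>r\<close> is imaginary, \<open>2 * r * \<beta>\<close> and \<open>\<i> * q\<close> drop out of the real part of the identity above.\<close>
lemma Re_subleading_coefficient:
  fixes f u :: "complex \<Rightarrow> complex"
  assumes y: "a < y" "y < b" and "0 < \<epsilon>"
    and \<phi>: "(\<phi> has_real_derivative p) (at y)" and \<beta>: "C1_on {a..b} \<beta>"
    and f: "\<And>x y. Complex x y \<in> off_pole (closure (strip a b \<epsilon>)) \<Longrightarrow>
      f (Complex x y) = cis (\<phi> y) * (of_real (\<beta> y) / of_real x + \<beta>0 y + Rf x y)"
    and Rf: "(\<lambda>(x, y). Rf x y) \<in> O[near_pole a b](\<lambda>(x, y). of_real x)"
    and C1: "extends_C1_on (closure (strip a b \<epsilon>))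
      (\<lambda>\<tau>. f \<tau> - cis (\<phi> (Im \<tau>)) * of_real (\<beta> (Im \<tau>)) / of_real (Re \<tau>))"
    and eq: "generalized_analytic_on (off_pole (strip a b \<epsilon>)) u f"
    and u: "\<And>x. 0 < x \<Longrightarrow> x < \<epsilon> \<Longrightarrow>
      u (Complex x y) = cis (2 * \<phi> y) * (- 1 / (2 * of_real x) + v x)"
    and v: "(v \<longlongrightarrow> r) (at_right 0)" and r: "Re r = 0"
  shows "Re (\<beta>0 y) = p * \<beta> y"
proof -
  obtain g where g: "C1_on (closure (strip a b \<epsilon>)) g"
    and gf: "\<And>\<tau>. \<tau> \<in> off_pole (closure (strip a b \<epsilon>)) \<Longrightarrow>
      g \<tau> = f \<tau> - cis (\<phi> (Im \<tau>)) * of_real (\<beta> (Im \<tau>)) / of_real (Re \<tau>)"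
    using C1 unfolding extends_C1_on_def by blast
  obtain q where q: "(\<beta> has_real_derivative q) (at y)"
    using C1_on_real_derivative[OF \<beta> y] .
  have Rf0: "((\<lambda>x. Rf x y) \<longlongrightarrow> 0) (at_right 0)"
    using bigo_near_pole_tendsto_0[OF Rf tendsto_complex_of_real_0] y by simp
  have lim: "((\<lambda>x. \<beta>0 y + Rf x y) \<longlongrightarrow> \<beta>0 y) (at_right 0)"
    using tendsto_add[OF tendsto_const Rf0] by simp
  have "\<forall>\<^sub>F x in at_right 0. cis (- \<phi> y) * g (Complex x y) = \<beta>0 y + Rf x y"
    using eventually_at_right_real[OF \<open>0 < \<epsilon>\<close>]
  proof eventually_elim
    case (elim x)
    then have in_strip: "Complex x y \<in> off_pole (closure (strip a b \<epsilon>))"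
      using y by (simp add: off_pole_def closure_strip)
    have "cis (- \<phi> y) * (cis (\<phi> y) * (\<beta>0 y + Rf x y)) = \<beta>0 y + Rf x y"
      by (simp add: mult.assoc[symmetric] cis_mult)
    moreover have "g (Complex x y) = cis (\<phi> y) * (\<beta>0 y + Rf x y)"
      unfolding gf[OF in_strip] f[OF in_strip] by (simp add: algebra_simps)
    ultimately show ?case by simp
  qed
  then have c: "((\<lambda>x. cis (- \<phi> y) * g (Complex x y)) \<longlongrightarrow> \<beta>0 y) (at_right 0)"
    by (rule iffD2[OF tendsto_cong lim])
  have "- (of_real p * of_real (\<beta> y)) + \<i> * of_real q = 2 * r * \<beta> y - cnj (\<beta>0 y)"
    by (rule subleading_coefficient[OF y \<open>0 < \<epsilon>\<close> \<phi> q g _ eq u v c]) (simp_all add: gf)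
  then have "Re (- (of_real p * of_real (\<beta> y)) + \<i> * of_real q) = Re (2 * r * \<beta> y - cnj (\<beta>0 y))"
    by (rule arg_cong)
  then show ?thesis using r by simp
qed

section \<open>The potential and the quotient\<close>

lemma potential_x_derivative:
  assumes "potential_on D f fp \<omega>" "Complex x y \<in> D"
  shows "((\<lambda>s. \<omega> (Complex s y)) has_vector_derivative
    2 * \<i> * complex_of_real (Im (f (Complex x y) * fp (Complex x y)))) (at x)"
proof -
  let ?\<tau> = "Complex x y"
  let ?D = "frechet_derivative \<omega> (at ?\<tau>)"
  have diff: "\<omega> differentiable (at ?\<tau>)" and "wirtinger_d \<omega> ?\<tau> = f ?\<tau> * fp ?\<tau>"
    and "wirtinger_dbar \<omega> ?\<tau> = - cnj (f ?\<tau> * fp ?\<tau>)"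
    using assms by (auto simp: potential_on_def)
  moreover have "?D 1 = wirtinger_d \<omega> ?\<tau> + wirtinger_dbar \<omega> ?\<tau>"
    by (simp add: wirtinger_d_def wirtinger_dbar_def add_divide_distrib[symmetric])
  ultimately have "?D 1 = f ?\<tau> * fp ?\<tau> - cnj (f ?\<tau> * fp ?\<tau>)"
    by simp
  then have D1: "?D 1 = 2 * \<i> * complex_of_real (Im (f ?\<tau> * fp ?\<tau>))"
    by (simp only: complex_diff_cnj of_real_mult of_real_numeral mult_ac)
  have D: "(\<omega> has_derivative ?D) (at ?\<tau>)"
    using diff frechet_derivative_works by blast
  have "((\<lambda>s. Complex s y) has_vector_derivative 1) (at x)"
    unfolding Complex_eq by (auto intro!: derivative_eq_intros)
  from vector_derivative_diff_chain_within[OF this, of \<omega> ?D] D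
  have "((\<lambda>s. \<omega> (Complex s y)) has_vector_derivative ?D 1) (at x)"
    by (auto simp: o_def intro: has_derivative_at_withinI)
  then show ?thesis
    unfolding D1 .
qed

text \<open>Over a common denominator, the double-pole coefficients of the product divided by the pole coefficient
  of \<open>\<omega>\<close> give exactly \<open>1 / (2 * x)\<close>; what is left is the quotient \<open>N / (2 * V)\<close> with
  \<open>V = - \<i> * x * \<omega>\<close>, whose denominator stays away from \<open>0\<close> because \<open>\<beta> * \<beta>p\<close> does.\<close>
lemma pole_cancellation:
  fixes x \<beta> \<beta>p m B M K :: real and h k e \<omega> :: complex
  assumes x: "x \<noteq> 0" "\<bar>x\<bar> \<le> 1" "\<bar>x\<bar> * K \<le> m"
    and \<beta>: "\<bar>\<beta>\<bar> \<le> B" "\<bar>\<beta>p\<bar> \<le> B" "0 < m" "m \<le> \<beta> * \<beta>p"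
    and hk: "norm h \<le> M" "norm k \<le> M" and e: "norm e \<le> K"
    and \<omega>: "\<omega> = 2 * \<i> * (\<beta> * \<beta>p) / x + e"
  shows "\<omega> \<noteq> 0"
    and "norm (\<i> * (\<beta> / x + h) * (\<beta>p / x + k) / \<omega> - 1 / (2 * x)) \<le> (4 * B * M + 2 * M^2 + K) / (2 * m)"
proof -
  define X where "X = complex_of_real x"
  have X: "X \<noteq> 0" using x by (simp add: X_def)
  define V where "V = 2 * (\<beta> * \<beta>p) - \<i> * X * e"
  have "norm (\<i> * X * e) \<le> m"
    using order_trans[OF mult_left_mono[OF e abs_ge_zero[of x]] x(3)] by (simp add: norm_mult X_def)
  moreover have "norm (complex_of_real (2 * (\<beta> * \<beta>p))) \<ge> 2 * m"
    unfolding norm_of_real using \<beta> by linarith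
  ultimately have V: "m \<le> norm V"
    unfolding V_def using norm_triangle_ineq2[of "complex_of_real (2 * (\<beta> * \<beta>p))" "\<i> * X * e"] by simp
  then have "V \<noteq> 0" using \<open>0 < m\<close> by auto
  have \<omega>V: "\<omega> = \<i> * V / X"
    using X unfolding \<omega> V_def X_def[symmetric] by (simp add: field_simps)
  then show "\<omega> \<noteq> 0" using X \<open>V \<noteq> 0\<close> by simp
  define N where "N = 2 * (\<beta> * k + \<beta>p * h + X * h * k) + \<i> * e"
  have "\<i> * (\<beta> / X + h) * (\<beta>p / X + k) / \<omega> - 1 / (2 * X) = N / (2 * V)"
    using X \<open>V \<noteq> 0\<close> unfolding \<omega>V by (simp add: field_simps) (simp add: N_def V_def algebra_simps)
  moreover have "norm N \<le> 4 * B * M + 2 * M^2 + K"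
  proof -
    have B: "0 \<le> B" "0 \<le> M" using \<beta> hk norm_ge_zero[of h] by linarith+
    have 1: "norm (\<beta> * k) \<le> B * M" "norm (\<beta>p * h) \<le> B * M"
      using \<beta> hk B by (auto simp: norm_mult intro!: mult_mono)
    have "norm (X * h * k) \<le> 1 * M * M"
      unfolding norm_mult using hk B x by (intro mult_mono) (auto simp: X_def)
    with 1 have "norm (\<beta> * k + \<beta>p * h + X * h * k) \<le> B * M + B * M + M^2"
      by (intro norm_triangle_mono) (auto simp: power2_eq_square)
    then have "norm (2 * (\<beta> * k + \<beta>p * h + X * h * k)) \<le> 4 * B * M + 2 * M^2"
      unfolding norm_mult by simp
    moreover have "norm (\<i> * e) \<le> K" using e by (simp add: norm_mult)
    ultimately show ?thesis unfolding N_def by (rule norm_triangle_mono)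
  qed
  ultimately have "norm (\<i> * (\<beta> / X + h) * (\<beta>p / X + k) / \<omega> - 1 / (2 * X))
      \<le> (4 * B * M + 2 * M^2 + K) / (2 * m)"
    using V \<open>0 < m\<close>
    by (auto simp: norm_divide norm_mult intro!: frac_le intro: order_trans[OF norm_ge_zero])
  then show "norm (\<i> * (\<beta> / x + h) * (\<beta>p / x + k) / \<omega> - 1 / (2 * x)) \<le> (4 * B * M + 2 * M^2 + K) / (2 * m)"
    by (simp add: X_def)
qed

section \<open>Cancellation of the pole by the Moutard transform\<close>

theorem theorem3:
  fixes a b \<epsilon> :: real
    and u f fp \<omega> :: "complex \<Rightarrow> complex"
    and \<phi> \<beta> \<beta>p :: "real \<Rightarrow> real"
    and r0 r1 \<beta>0 \<beta>p0 :: "real \<Rightarrow> complex"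
    and Ru Rf Rfp :: "real \<Rightarrow> real \<Rightarrow> complex"
  assumes "a < b" and "\<epsilon> > 0"
    and "C2_on {a..b} \<phi>"
    and u_expansion: "\<And>x y. Complex x y \<in> off_pole (closure (strip a b \<epsilon>)) \<Longrightarrow>
      u (Complex x y) =
        cis (2 * \<phi> y) * (- 1 / (2 * of_real x) + r0 y + r1 y * of_real x + Ru x y)"
    and "(\<lambda>(x, y). Ru x y) \<in> O[near_pole a b](\<lambda>(x, y). of_real (x ^ 2))"
    and "extends_C1_on (closure (strip a b \<epsilon>))
      (\<lambda>\<tau>. u \<tau> + cis (2 * \<phi> (Im \<tau>)) / (2 * of_real (Re \<tau>)))"
    and "\<And>y. y \<in> {a<..<b} \<Longrightarrow> Re (r0 y) = 0"
    and "\<And>y. y \<in> {a<..<b} \<Longrightarrow> Im (r1 y) = 1 / 2 * (deriv ^^ 2) \<phi> y"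
    and "generalized_analytic_on (off_pole (strip a b \<epsilon>)) u f"
    and "generalized_analytic_on (off_pole (strip a b \<epsilon>)) (\<lambda>\<tau>. - cnj (u \<tau>)) fp"
    and f_expansion: "\<And>x y. Complex x y \<in> off_pole (closure (strip a b \<epsilon>)) \<Longrightarrow>
      f (Complex x y) = cis (\<phi> y) * (of_real (\<beta> y) / of_real x + \<beta>0 y + Rf x y)"
    and "smooth_remainder a b Rf"
    and "extends_C1_on (closure (strip a b \<epsilon>))
      (\<lambda>\<tau>. f \<tau> - cis (\<phi> (Im \<tau>)) * of_real (\<beta> (Im \<tau>)) / of_real (Re \<tau>))"
    and fp_expansion: "\<And>x y. Complex x y \<in> off_pole (closure (strip a b \<epsilon>)) \<Longrightarrow>
      fp (Complex x y) = cis (- (\<phi> y + pi / 2)) * (of_real (\<beta>p y) / of_real x + \<beta>p0 y + Rfp x y)"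
    and "smooth_remainder a b Rfp"
    and "extends_C1_on (closure (strip a b \<epsilon>))
      (\<lambda>\<tau>. fp \<tau> - cis (- (\<phi> (Im \<tau>) + pi / 2)) * of_real (\<beta>p (Im \<tau>)) / of_real (Re \<tau>))"
    and "C1_on {a..b} \<beta>" and "C1_on {a..b} \<beta>p"
    and "\<And>y. y \<in> {a..b} \<Longrightarrow> \<beta> y > 0" and "\<And>y. y \<in> {a..b} \<Longrightarrow> \<beta>p y > 0"
    and "potential_on (off_pole (strip a b \<epsilon>)) f fp \<omega>"
    and \<omega>_boundary_values: "continuous_on (off_pole (closure (strip a b \<epsilon>))) \<omega>"
  shows "\<exists>\<delta>\<in>{0<..<\<epsilon>}.
    (\<forall>\<tau>\<in>off_pole (closure (strip a b \<delta>)). \<omega> \<tau> \<noteq> 0) \<and>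
    bounded (simple_moutard u f fp \<omega> ` off_pole (closure (strip a b \<delta>)))"
proof -
  note ab = \<open>a < b\<close> and \<epsilon> = \<open>0 < \<epsilon>\<close>
  let ?S = "closure (strip a b \<epsilon>)"
  let ?\<phi>p = "\<lambda>y. - (\<phi> y + pi / 2)"
  have inS: "Complex x y \<in> off_pole ?S" if "x \<noteq> 0" "\<bar>x\<bar> \<le> \<epsilon>" "a \<le> y" "y \<le> b" for x y
    using that ab \<epsilon> by (simp add: off_pole_def closure_strip)
  have Rf: "(\<lambda>(x, y). Rf x y) \<in> O[near_pole a b](\<lambda>(x, y). of_real x)"
    and Rfp: "(\<lambda>(x, y). Rfp x y) \<in> O[near_pole a b](\<lambda>(x, y). of_real x)"
    using assms(12,15) by (simp_all add: smooth_remainder_def)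

  have v_lim: "((\<lambda>x. r0 y + r1 y * of_real x + Ru x y) \<longlongrightarrow> r0 y) (at_right 0)" if y: "a < y" "y < b" for y
  proof -
    have "((\<lambda>x. complex_of_real (x^2)) \<longlongrightarrow> 0) (at_right 0)"
      by (auto intro!: tendsto_eq_intros)
    then have "((\<lambda>x. Ru x y) \<longlongrightarrow> 0) (at_right 0)"
      using bigo_near_pole_tendsto_0[OF assms(5)] y by simp
    note this tendsto_complex_of_real_0
    then have "((\<lambda>x. r0 y + r1 y * of_real x + Ru x y) \<longlongrightarrow> r0 y + r1 y * 0 + 0) (at_right 0)"
      by (intro tendsto_intros)
    then show ?thesis by simp
  qed

  \<comment> \<open>\<open>fp\<close> solves the same kind of equation as \<open>f\<close>: with the phase \<open>?\<phi>p\<close>, the coefficient \<open>- cnj u\<close> is again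
      \<open>cis (2 * ?\<phi>p)\<close> times the sum of \<open>- 1 / (2 * x)\<close> and a regular part, now with \<open>cnj (r0 y)\<close> in place of \<open>r0 y\<close>.
      The slope of \<open>?\<phi>p\<close> is opposite to that of \<open>\<phi>\<close>, whence the cancellation.\<close>
  have cancel: "\<beta> y * Re (\<beta>p0 y) + \<beta>p y * Re (\<beta>0 y) = 0" if y: "a < y" "y < b" for y
  proof -
    obtain D where D: "\<forall>y\<in>{a..b}. (\<phi> has_real_derivative D y) (at y within {a..b})"
      using assms(3) unfolding C2_on_def by blast
    have \<phi>: "(\<phi> has_real_derivative D y) (at y)"
      using bspec[OF D, of y] y at_within_Icc_at[OF y] by simp
    have r: "Re (r0 y) = 0" using assms(7) y by simp
    have "Re (\<beta>0 y) = D y * \<beta> y"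
    proof (rule Re_subleading_coefficient[OF y \<epsilon> \<phi> assms(17) f_expansion Rf assms(13,9) _ v_lim[OF y] r])
      show "u (Complex x y) = cis (2 * \<phi> y) * (- 1 / (2 * of_real x) + (r0 y + r1 y * of_real x + Ru x y))"
        if "0 < x" "x < \<epsilon>" for x
        using u_expansion[OF inS[of x y]] that y by (simp add: add.assoc)
    qed
    moreover have "Re (\<beta>p0 y) = - D y * \<beta>p y"
    proof (rule Re_subleading_coefficient[OF y \<epsilon> _ assms(18) fp_expansion Rfp assms(16,10) _ tendsto_cnj[OF v_lim[OF y]]])
      show "(?\<phi>p has_real_derivative - D y) (at y)"
        using \<phi> by (auto intro!: derivative_eq_intros)
      show "Re (cnj (r0 y)) = 0" using r by simp
      have "cis (2 * ?\<phi>p y) = - cis (- (2 * \<phi> y))"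
        by (simp add: complex_eq_iff algebra_simps cos_diff sin_diff)
      then show "- cnj (u (Complex x y)) =
          cis (2 * ?\<phi>p y) * (- 1 / (2 * of_real x) + cnj (r0 y + r1 y * of_real x + Ru x y))"
        if "0 < x" "x < \<epsilon>" for x
        using u_expansion[OF inS[of x y]] that y by (simp add: add.assoc cis_cnj)
    qed
    ultimately show ?thesis by (simp add: algebra_simps)
  qed

  define h where "h x y = \<beta>0 y + Rf x y" for x y
  define k where "k x y = \<beta>p0 y + Rfp x y" for x y
  have f_eq: "f (Complex x y) = cis (\<phi> y) * (\<beta> y / x + h x y)"
    and fp_eq: "fp (Complex x y) = cis (?\<phi>p y) * (\<beta>p y / x + k x y)"
    if "x \<noteq> 0" "\<bar>x\<bar> \<le> \<epsilon>" "a \<le> y" "y \<le> b" for x y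
    using f_expansion[OF inS[OF that]] fp_expansion[OF inS[OF that]] by (simp_all add: h_def k_def add.assoc)
  obtain M1 where "0 < M1" and M1: "\<And>\<tau>. \<tau> \<in> off_pole ?S \<Longrightarrow>
      norm (f \<tau> - cis (\<phi> (Im \<tau>)) * of_real (\<beta> (Im \<tau>)) / of_real (Re \<tau>)) \<le> M1"
    using bounded_if_extends_C1_on[OF assms(13)] by blast
  obtain M2 where "0 < M2" and M2: "\<And>\<tau>. \<tau> \<in> off_pole ?S \<Longrightarrow>
      norm (fp \<tau> - cis (?\<phi>p (Im \<tau>)) * of_real (\<beta>p (Im \<tau>)) / of_real (Re \<tau>)) \<le> M2"
    using bounded_if_extends_C1_on[OF assms(16)] by blast
  obtain Mu where Mu: "\<And>\<tau>. \<tau> \<in> off_pole ?S \<Longrightarrow>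
      norm (u \<tau> + cis (2 * \<phi> (Im \<tau>)) / (2 * of_real (Re \<tau>))) \<le> Mu"
    using bounded_if_extends_C1_on[OF assms(6)] by blast
  define M where "M = max M1 M2"
  have "0 < M" using \<open>0 < M1\<close> by (simp add: M_def)
  have hM: "norm (h x y) \<le> M" and kM: "norm (k x y) \<le> M"
    if "x \<noteq> 0" "\<bar>x\<bar> \<le> \<epsilon>" "a \<le> y" "y \<le> b" for x y
  proof -
    have "f (Complex x y) - cis (\<phi> y) * \<beta> y / x = cis (\<phi> y) * h x y"
      unfolding f_eq[OF that] by (simp add: algebra_simps)
    then show "norm (h x y) \<le> M"
      using M1[OF inS[OF that]] by (simp add: M_def norm_mult)
    have "fp (Complex x y) - cis (?\<phi>p y) * \<beta>p y / x = cis (?\<phi>p y) * k x y"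
      unfolding fp_eq[OF that] by (simp add: algebra_simps)
    then show "norm (k x y) \<le> M"
      using M2[OF inS[OF that]] by (simp add: M_def norm_mult)
  qed

  have cont: "continuous_on {a..b} \<beta>" "continuous_on {a..b} \<beta>p"
    using assms(17,18) C1_on_imp_continuous_on by auto
  obtain B1 B2 where B1: "\<forall>y\<in>{a..b}. norm (\<beta> y) \<le> B1" and B2: "\<forall>y\<in>{a..b}. norm (\<beta>p y) \<le> B2"
    using compact_imp_bounded[OF compact_continuous_image[OF cont(1) compact_Icc]]
      compact_imp_bounded[OF compact_continuous_image[OF cont(2) compact_Icc]]
    unfolding bounded_iff by auto
  define B where "B = max B1 B2"
  have B: "\<bar>\<beta> y\<bar> \<le> B" "\<bar>\<beta>p y\<bar> \<le> B" if "a \<le> y" "y \<le> b" for y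
    using B1 B2 that by (auto simp: B_def le_max_iff_disj)
  have "0 \<le> B" using B(1)[of a] ab by linarith
  have "continuous_on {a..b} (\<lambda>y. \<beta> y * \<beta>p y)"
    using cont by (intro continuous_intros)
  then obtain y0 where "y0 \<in> {a..b}" and y0: "\<And>y. y \<in> {a..b} \<Longrightarrow> \<beta> y0 * \<beta>p y0 \<le> \<beta> y * \<beta>p y"
    using continuous_attains_inf[OF compact_Icc, of a b "\<lambda>y. \<beta> y * \<beta>p y"] ab by auto
  define m where "m = \<beta> y0 * \<beta>p y0"
  have "0 < m" using assms(19,20) \<open>y0 \<in> {a..b}\<close> by (simp add: m_def)

  obtain C1 d1 where "0 < C1" "0 < d1" and C1:
    "\<And>x y. 0 < \<bar>x\<bar> \<Longrightarrow> \<bar>x\<bar> < d1 \<Longrightarrow> a \<le> y \<Longrightarrow> y \<le> b \<Longrightarrow> norm (Rf x y) \<le> C1 * norm (complex_of_real x)"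
    using bigo_near_pole_uniform[OF Rf] by blast
  obtain C2 d2 where "0 < C2" "0 < d2" and C2:
    "\<And>x y. 0 < \<bar>x\<bar> \<Longrightarrow> \<bar>x\<bar> < d2 \<Longrightarrow> a \<le> y \<Longrightarrow> y \<le> b \<Longrightarrow> norm (Rfp x y) \<le> C2 * norm (complex_of_real x)"
    using bigo_near_pole_uniform[OF Rfp] by blast
  \<comment> \<open>halved so that the bounds hold up to and including \<open>\<bar>x\<bar> = \<delta>0\<close>, strictly inside the strip\<close>
  define \<delta>0 where "\<delta>0 = min \<epsilon> (min d1 d2) / 2"
  have \<delta>0: "0 < \<delta>0" "\<delta>0 < \<epsilon>" "\<delta>0 < d1" "\<delta>0 < d2"
    using \<epsilon> \<open>0 < d1\<close> \<open>0 < d2\<close> by (auto simp: \<delta>0_def)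

  \<comment> \<open>\<open>e\<close> is the potential with its pole removed, and \<open>e'\<close> its derivative in \<open>x\<close>\<close>
  define e where "e \<tau> = \<omega> \<tau> - 2 * \<i> * (\<beta> (Im \<tau>) * \<beta>p (Im \<tau>)) / Re \<tau>" for \<tau>
  define e' where "e' \<tau> = 2 * \<i> * complex_of_real
      (Im (f \<tau> * fp \<tau>) + \<beta> (Im \<tau>) * \<beta>p (Im \<tau>) / (Re \<tau>)^2)" for \<tau>
  have e_deriv: "((\<lambda>s. e (Complex s y)) has_vector_derivative e' (Complex x y)) (at x)"
    if x: "0 < \<bar>x\<bar>" "\<bar>x\<bar> \<le> \<delta>0" and y: "a < y" "y < b" for x y
  proof -
    let ?W = "2 * \<i> * complex_of_real (Im (f (Complex x y) * fp (Complex x y)))"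
    have "Complex x y \<in> off_pole (strip a b \<epsilon>)"
      using x y \<delta>0 by (auto simp: off_pole_def strip_def)
    then have "((\<lambda>s. \<omega> (Complex s y)) has_vector_derivative ?W) (at x)"
      by (rule potential_x_derivative[OF assms(21)])
    moreover have "((\<lambda>s. 2 * \<i> * (\<beta> y * \<beta>p y) / s) has_vector_derivative
        - (2 * \<i> * (\<beta> y * \<beta>p y) / x^2)) (at x)"
    proof (rule has_vector_derivative_real_field)
      show "((\<lambda>z. 2 * \<i> * (\<beta> y * \<beta>p y) / z) has_field_derivative
          - (2 * \<i> * (\<beta> y * \<beta>p y) / x^2)) (at (complex_of_real x))"
        using x by (auto intro!: derivative_eq_intros simp: power2_eq_square)
    qed
    ultimately have "((\<lambda>s. \<omega> (Complex s y) - 2 * \<i> * (\<beta> y * \<beta>p y) / s) has_vector_derivative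
        ?W - - (2 * \<i> * (\<beta> y * \<beta>p y) / x^2)) (at x)"
      by (rule has_vector_derivative_diff)
    moreover have "?W - - (2 * \<i> * (\<beta> y * \<beta>p y) / x^2) = e' (Complex x y)"
      unfolding e'_def by (simp add: algebra_simps)
    ultimately show ?thesis
      by (simp add: e_def)
  qed
  have e'_bound: "norm (e' (Complex x y)) \<le> 2 * (B * C2 + B * C1 + M * M)"
    if x: "0 < \<bar>x\<bar>" "\<bar>x\<bar> \<le> \<delta>0" and y: "a < y" "y < b" for x y
  proof -
    have x\<epsilon>: "x \<noteq> 0" "\<bar>x\<bar> \<le> \<epsilon>" "a \<le> y" "y \<le> b" using x y \<delta>0 by auto
    have "cis (\<phi> y) * cis (?\<phi>p y) = - \<i>"
      by (simp add: cis_mult complex_eq_iff)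
    then have "f (Complex x y) * fp (Complex x y) = - \<i> * ((\<beta> y / x + h x y) * (\<beta>p y / x + k x y))"
      unfolding f_eq[OF x\<epsilon>] fp_eq[OF x\<epsilon>] by (metis mult.assoc mult.left_commute)
    then have "Im (f (Complex x y) * fp (Complex x y)) = - Re ((\<beta> y / x + h x y) * (\<beta>p y / x + k x y))"
      by simp
    also have "\<dots> = - (\<beta> y * \<beta>p y / x^2) - (\<beta> y * Re (k x y) + \<beta>p y * Re (h x y)) / x - Re (h x y * k x y)"
      using x by (simp add: power2_eq_square field_simps)
    \<comment> \<open>the only possible source of a logarithm in \<open>e\<close>; the remainders left over are \<open>O(x)\<close>\<close>
    also have "\<beta> y * Re (k x y) + \<beta>p y * Re (h x y) = \<beta> y * Re (Rfp x y) + \<beta>p y * Re (Rf x y)"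
      using cancel[OF y] by (simp add: h_def k_def algebra_simps)
    finally have eq: "Im (f (Complex x y) * fp (Complex x y)) + \<beta> y * \<beta>p y / x^2 =
        - ((\<beta> y * (Re (Rfp x y) / x) + \<beta>p y * (Re (Rf x y) / x)) + Re (h x y * k x y))"
      by (simp add: add_divide_distrib)
    have le: "\<bar>Re (Rfp x y) / x\<bar> \<le> C2" "\<bar>Re (Rf x y) / x\<bar> \<le> C1"
      using order_trans[OF abs_Re_le_cmod C2[of x y]] order_trans[OF abs_Re_le_cmod C1[of x y]] x y \<delta>0
      by (auto simp: divide_le_eq)
    have "\<bar>\<beta> y * (Re (Rfp x y) / x)\<bar> \<le> B * C2" "\<bar>\<beta>p y * (Re (Rf x y) / x)\<bar> \<le> B * C1"
      unfolding abs_mult using mult_mono[OF B(1) le(1)] mult_mono[OF B(2) le(2)] x\<epsilon> \<open>0 \<le> B\<close> by simp_all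
    moreover have "\<bar>Re (h x y * k x y)\<bar> \<le> M * M"
      using hM[OF x\<epsilon>] kM[OF x\<epsilon>] \<open>0 < M\<close>
      by (intro order_trans[OF abs_Re_le_cmod]) (auto simp: norm_mult intro!: mult_mono)
    ultimately have "\<bar>Im (f (Complex x y) * fp (Complex x y)) + \<beta> y * \<beta>p y / x^2\<bar> \<le> B * C2 + B * C1 + M * M"
      unfolding eq by linarith
    then show ?thesis
      unfolding e'_def complex.sel norm_mult norm_of_real by simp
  qed
  have e_cont: "continuous_on (off_pole ?S) e"
  proof -
    have "Im ` off_pole ?S \<subseteq> {a..b}"
      using ab \<epsilon> by (auto simp: off_pole_def closure_strip)
    then have "continuous_on (off_pole ?S) (\<lambda>\<tau>. \<beta> (Im \<tau>))" "continuous_on (off_pole ?S) (\<lambda>\<tau>. \<beta>p (Im \<tau>))"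
      by (auto intro!: continuous_on_compose2[OF cont(1)] continuous_on_compose2[OF cont(2)] continuous_intros)
    then show ?thesis
      unfolding e_def using \<omega>_boundary_values
      by (intro continuous_intros) (auto simp: off_pole_def)
  qed
  obtain K where "0 < K" and K:
    "\<And>x y. 0 < \<bar>x\<bar> \<Longrightarrow> \<bar>x\<bar> \<le> \<delta>0 \<Longrightarrow> a \<le> y \<Longrightarrow> y \<le> b \<Longrightarrow> norm (e (Complex x y)) \<le> K"
    using bounded_near_pole_if_x_derivative_bounded[OF ab \<delta>0(1,2) e_cont e_deriv e'_bound] by blast

  \<comment> \<open>\<open>m / K\<close> keeps \<open>x * e\<close> within half of the pole coefficient of \<open>\<omega>\<close>, so that \<open>\<omega>\<close> has no zero\<close>
  define \<delta> where "\<delta> = min \<delta>0 (min 1 (m / K))"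
  have \<delta>: "0 < \<delta>" "\<delta> \<le> \<delta>0" "\<delta> \<le> 1" "\<delta> \<le> m / K"
    using \<delta>0 \<open>0 < m\<close> \<open>0 < K\<close> by (auto simp: \<delta>_def)
  define L where "L = Mu + (4 * B * M + 2 * M^2 + K) / (2 * m)"
  have main: "\<omega> \<tau> \<noteq> 0 \<and> norm (simple_moutard u f fp \<omega> \<tau>) \<le> L"
    if "\<tau> \<in> off_pole (closure (strip a b \<delta>))" for \<tau>
  proof -
    define x y where "x = Re \<tau>" and "y = Im \<tau>"
    have \<tau>: "\<tau> = Complex x y" by (simp add: x_def y_def)
    have x: "x \<noteq> 0" "\<bar>x\<bar> \<le> \<delta>" and y: "a \<le> y" "y \<le> b"
      using that ab \<delta> by (auto simp: x_def y_def off_pole_def closure_strip)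
    have x\<epsilon>: "x \<noteq> 0" "\<bar>x\<bar> \<le> \<epsilon>" "a \<le> y" "y \<le> b" using x y \<delta> \<delta>0 by auto
    have "\<bar>x\<bar> * K \<le> m"
      using x \<delta> \<open>0 < K\<close> by (simp add: pos_le_divide_eq[symmetric])
    moreover have "m \<le> \<beta> y * \<beta>p y" using y0[of y] y by (simp add: m_def)
    moreover have "\<omega> \<tau> = 2 * \<i> * (\<beta> y * \<beta>p y) / x + e \<tau>"
      by (simp add: e_def x_def y_def)
    moreover have "norm (e \<tau>) \<le> K" using K[of x y] x y \<delta> by (simp add: \<tau>)
    ultimately have ne: "\<omega> \<tau> \<noteq> 0" and q: "norm (\<i> * (\<beta> y / x + h x y) * (\<beta>p y / x + cnj (k x y)) / \<omega> \<tau> - 1 / (2 * x))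
        \<le> (4 * B * M + 2 * M^2 + K) / (2 * m)"
      using pole_cancellation[of x K m "\<beta> y" B "\<beta>p y" "h x y" M "cnj (k x y)" "e \<tau>" "\<omega> \<tau>"]
        x \<delta> B[OF y] \<open>0 < m\<close> hM[OF x\<epsilon>] kM[OF x\<epsilon>] by auto
    have "cnj (cis (?\<phi>p y)) = cis (\<phi> y) * \<i>"
      by (simp add: cis_cnj flip: cis_mult)
    moreover have "cis (2 * \<phi> y) = cis (\<phi> y) * cis (\<phi> y)"
      by (simp add: cis_mult)
    ultimately have "cis (\<phi> y) * cnj (cis (?\<phi>p y)) = cis (2 * \<phi> y) * \<i>"
      by simp
    then have "f \<tau> * cnj (fp \<tau>) = cis (2 * \<phi> y) * (\<i> * (\<beta> y / x + h x y) * (\<beta>p y / x + cnj (k x y)))"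
      unfolding \<tau> f_eq[OF x\<epsilon>] fp_eq[OF x\<epsilon>] complex_cnj_mult complex_cnj_add complex_cnj_divide complex_cnj_complex_of_real
      by (metis mult.assoc mult.left_commute)
    then have "simple_moutard u f fp \<omega> \<tau> = (u \<tau> + cis (2 * \<phi> y) / (2 * x)) +
        cis (2 * \<phi> y) * (\<i> * (\<beta> y / x + h x y) * (\<beta>p y / x + cnj (k x y)) / \<omega> \<tau> - 1 / (2 * x))"
      unfolding simple_moutard_def by (simp add: algebra_simps)
    moreover have "norm (u \<tau> + cis (2 * \<phi> y) / (2 * x)) \<le> Mu"
      using Mu[OF inS[OF x\<epsilon>]] by (simp add: \<tau>)
    moreover have "norm (cis (2 * \<phi> y) * (\<i> * (\<beta> y / x + h x y) * (\<beta>p y / x + cnj (k x y)) / \<omega> \<tau> - 1 / (2 * x)))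
        \<le> (4 * B * M + 2 * M^2 + K) / (2 * m)"
      using q by (simp only: norm_mult norm_cis mult_1_left)
    ultimately have "norm (simple_moutard u f fp \<omega> \<tau>) \<le> L"
      unfolding L_def using norm_triangle_mono by metis
    with ne show ?thesis by blast
  qed
  show ?thesis
  proof (rule bexI[of _ \<delta>], intro conjI ballI)
    show "bounded (simple_moutard u f fp \<omega> ` off_pole (closure (strip a b \<delta>)))"
      unfolding bounded_iff using main by blast
  qed (use main \<delta> \<delta>0 in auto)
qed

end
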